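(* Let $\mathcal X\subseteq\mathbb R^n$ be open, let $(E,z)$ be a gradient pair for $\mathcal H\in C^1(\mathcal X,\mathbb R)$, and let $(\varphi,U)$ be a system transformation, with $\varphi\in C^1(\widetilde{\mathcal X},\mathcal X)$ and $U\in C(\widetilde{\mathcal X},\mathbb R^{n,n})$. Then $$(\widetilde E,\tilde z)=\big(U^\top(E\circ\varphi)\,\mathrm D\varphi,\ U^{-1}(z\circ\varphi)\big)$$ is a gradient pair for $\widetilde{\mathcal H}=\mathcal H\circ\varphi$. Furthermore, let $(\overline E,\overline z)$ be a discrete gradient pair for $(\mathcal H,E,z)$, let $\overline{\mathrm D}\varphi$ be a discrete Jacobian for $\varphi$, and let $\overline U\in C(\widetilde{\mathcal X}\times\widetilde{\mathcal X},\mathbb R^{n,n})$ be a pointwise invertible consistent discretization of $U$. Then $(\widehat E,\hat z)$ with $$\widehat E(\tilde x,\tilde x')=\overline U(\tilde x,\tilde x')^\top\,\overline E(\varphi(\tilde x),\varphi(\tilde x'))\,\overline{\mathrm D}\varphi(\tilde x,\tilde x'),\qquad \hat z(\tilde x,\tilde x')=\overline U(\tilde x,\tilde x')^{-1}\,\overline z(\varphi(\tilde x),\varphi(\tilde x'))$$ for $\tilde x,\tilde x'\in\widetilde{\mathcal X}$ is a discrete gradient pair for $(\widetilde{\mathcal H},\widetilde E,\tilde z)$.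
   Context: For $\mathcal X\subseteq\mathbb R^n$ open, $E\in C(\mathcal X,\mathbb R^{n,n})$, $z\in C(\mathcal X,\mathbb R^n)$, the pair $(E,z)$ is a gradient pair for $\mathcal H\in C^1(\mathcal X,\mathbb R)$ if $E(x)^\top z(x)=\nabla\mathcal H(x)$ (column vector) for all $x\in\mathcal X$. An (invertible) system transformation is a pair $(\varphi,U)$ with $\varphi\in C^1(\widetilde{\mathcal X},\mathcal X)$ a diffeomorphism between open sets $\widetilde{\mathcal X},\mathcal X\subseteq\mathbb R^n$ and $U\in C(\widetilde{\mathcal X},\mathbb R^{n,n})$ pointwise invertible. $U^\top$ and $U^{-1}$ are the pointwise transpose and inverse; $\mathrm D\varphi$ is the Jacobian. $(\overline E,\overline z)\in C(\mathcal X\times\mathcal X,\mathbb R^{n,n})\times C(\mathcal X\times\mathcal X,\mathbb R^n)$ is a discrete gradient pair for $(\mathcal H,E,z)$ (where $(E,z)$ is a gradient pair for $\mathcal H$) if $\overline z(x,x')^\top\overline E(x,x')(x'-x)=\mathcal H(x')-\mathcal H(x)$ for all $x,x'\in\mathcal X$, and $\overline E(x,x)=E(x)$, $\overline z(x,x)=z(x)$ for all $x\in\mathcal X$. A discrete Jacobian of $F\in C^1(\mathcal Y,\mathbb R^m)$, $\mathcal Y\subseteq\mathbb R^d$ open, is $\overline{\mathrm D}F\in C(\mathcal Y\times\mathcal Y,\mathbb R^{m,d})$ with $\overline{\mathrm D}F(x,x')(x'-x)=F(x')-F(x)$ for all $x,x'$ and $\overline{\mathrm D}F(x,x)=\mathrm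 DF(x)$ for all $x$. A continuous $\overline F$ on $\mathcal Y\times\mathcal Y$ is a consistent discretization of a continuous $F$ on $\mathcal Y$ if $\overline F(x,x)=F(x)$ for all $x$. *)

theory Defs
  imports "HOL-Analysis.Analysis"
begin

text \<open>
  Functions on a set \<open>X\<close> of \<open>real ^ 'n\<close> are total functions whose values outside \<open>X\<close> are irrelevant;
  functions on \<open>X \<times> X\<close> are curried.
\<close>

definition C1_on :: "'a::real_normed_vector set \<Rightarrow> ('a \<Rightarrow> 'b::real_normed_vector) \<Rightarrow> bool" where
  "C1_on X f \<longleftrightarrow> open X \<and>
     (\<exists>f'. (\<forall>x\<in>X. (f has_derivative blinfun_apply (f' x)) (at x)) \<and> continuous_on X f')"

definition C1_diffeomorphism ::
  "'a::real_normed_vector set \<Rightarrow> 'b::real_normed_vector set \<Rightarrow> ('a \<Rightarrow> 'b) \<Rightarrow> bool" where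
  "C1_diffeomorphism X Y f \<longleftrightarrow> bij_betw f X Y \<and> C1_on X f \<and> C1_on Y (inv_into X f)"

text \<open>\<open>GDERIV H x :> v\<close> says that \<open>H\<close> is differentiable at \<open>x\<close> with gradient (column vector) \<open>v\<close>.\<close>

definition gradient_pair ::
  "(real ^ 'n) set \<Rightarrow> (real ^ 'n \<Rightarrow> real) \<Rightarrow>
   (real ^ 'n \<Rightarrow> real ^ 'n ^ 'n) \<Rightarrow> (real ^ 'n \<Rightarrow> real ^ 'n) \<Rightarrow> bool" where
  "gradient_pair X H E z \<longleftrightarrow>
     open X \<and> C1_on X H \<and> continuous_on X E \<and> continuous_on X z \<and>
     (\<forall>x\<in>X. GDERIV H x :> transpose (E x) *v z x)"

definition system_transformation ::
  "(real ^ 'n) set \<Rightarrow> (real ^ 'n) set \<Rightarrow> (real ^ 'n \<Rightarrow> real ^ 'n) \<Rightarrow>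
   (real ^ 'n \<Rightarrow> real ^ 'n ^ 'n) \<Rightarrow> bool" where
  "system_transformation X' X \<phi> U \<longleftrightarrow>
     open X' \<and> open X \<and> C1_diffeomorphism X' X \<phi> \<and>
     continuous_on X' U \<and> (\<forall>x\<in>X'. invertible (U x))"

definition discrete_gradient_pair ::
  "(real ^ 'n) set \<Rightarrow> (real ^ 'n \<Rightarrow> real) \<Rightarrow>
   (real ^ 'n \<Rightarrow> real ^ 'n ^ 'n) \<Rightarrow> (real ^ 'n \<Rightarrow> real ^ 'n) \<Rightarrow>
   (real ^ 'n \<Rightarrow> real ^ 'n \<Rightarrow> real ^ 'n ^ 'n) \<Rightarrow> (real ^ 'n \<Rightarrow> real ^ 'n \<Rightarrow> real ^ 'n) \<Rightarrow> bool" where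
  "discrete_gradient_pair X H E z Eb zb \<longleftrightarrow>
     gradient_pair X H E z \<and>
     continuous_on (X \<times> X) (\<lambda>(x, x'). Eb x x') \<and>
     continuous_on (X \<times> X) (\<lambda>(x, x'). zb x x') \<and>
     (\<forall>x\<in>X. \<forall>x'\<in>X. zb x x' \<bullet> (Eb x x' *v (x' - x)) = H x' - H x) \<and>
     (\<forall>x\<in>X. Eb x x = E x \<and> zb x x = z x)"

definition discrete_jacobian ::
  "(real ^ 'd) set \<Rightarrow> (real ^ 'd \<Rightarrow> real ^ 'm) \<Rightarrow>
   (real ^ 'd \<Rightarrow> real ^ 'd \<Rightarrow> real ^ 'd ^ 'm) \<Rightarrow> bool" where
  "discrete_jacobian Y F DF \<longleftrightarrow>
     open Y \<and> C1_on Y F \<and>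
     continuous_on (Y \<times> Y) (\<lambda>(x, x'). DF x x') \<and>
     (\<forall>x\<in>Y. \<forall>x'\<in>Y. DF x x' *v (x' - x) = F x' - F x) \<and>
     (\<forall>x\<in>Y. DF x x = jacobian F (at x))"

definition consistent_discretization ::
  "'a::topological_space set \<Rightarrow> ('a \<Rightarrow> 'b::topological_space) \<Rightarrow> ('a \<Rightarrow> 'a \<Rightarrow> 'b) \<Rightarrow> bool" where
  "consistent_discretization Y F Fb \<longleftrightarrow>
     continuous_on Y F \<and> continuous_on (Y \<times> Y) (\<lambda>(x, x'). Fb x x') \<and>
     (\<forall>x\<in>Y. Fb x x = F x)"

end

theory Submission
  imports Defs
begin

text \<open>Let J be the Jacobian of \<phi> at x. By the chain rule the gradient of H \<circ> \<phi>
  at x is J^T E^T z, with E and z taken at \<phi>(x). Inserting U U^{-1} = I between E^T and z and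
  regrouping gives J^T E^T U applied to U^{-1} z, which is the transformed pair
  (\<open>gradient_pair_transform\<close>). The discrete statement rests on the same cancellation
  (\<open>discrete_gradient_pair_transform\<close>). The chain rule is replaced by the exact
  identity that the discrete Jacobian sends x' - x to \<phi>(x') - \<phi>(x), so the discrete
  gradient identity between \<phi>(x) and \<phi>(x') becomes the one for H \<circ> \<phi> between x
  and x'. The remaining work is continuity of the new data. Products, transposes and compositions
  preserve it; the inverse is handled by \<open>continuous_on_matrix_inv_vector_mult\<close>, the
  Jacobian by \<open>C1_on_continuous_on_jacobian\<close>.\<close>

lemma continuous_on_matrix_matrix_mult:
  fixes A :: "'a::topological_space \<Rightarrow> real ^ 'n ^ 'm" and B :: "'a \<Rightarrow> real ^ 'k ^ 'n"
  assumes "continuous_on S A" "continuous_on S B"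
  shows "continuous_on S (\<lambda>x. A x ** B x)"
  unfolding matrix_matrix_mult_def
  by (intro continuous_on_vec_lambda continuous_intros assms)

lemma continuous_on_transpose:
  fixes A :: "'a::topological_space \<Rightarrow> real ^ 'n ^ 'm"
  assumes "continuous_on S A"
  shows "continuous_on S (\<lambda>x. transpose (A x))"
  unfolding transpose_def
  by (intro continuous_on_vec_lambda continuous_intros assms)

lemma continuous_on_det:
  fixes A :: "'a::topological_space \<Rightarrow> real ^ 'n ^ 'n"
  assumes "continuous_on S A"
  shows "continuous_on S (\<lambda>x. det (A x))"
  unfolding det_def by (intro continuous_intros assms)

lemma matrix_vector_mult_matrix_inv:
  fixes A :: "real ^ 'n ^ 'n"
  assumes "invertible A"
  shows "A *v (matrix_inv A *v v) = v"
  using someI_ex[OF assms[unfolded invertible_def]]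
  by (simp add: matrix_vector_mul_assoc matrix_inv_def)

text \<open>
  \<^const>\<open>matrix_inv\<close> is defined by choice; Cramer's rule supplies a formula whose continuity is visible.
\<close>

lemma continuous_on_matrix_inv_vector_mult:
  fixes A :: "'a::topological_space \<Rightarrow> real ^ 'n ^ 'n"
  assumes "continuous_on S A" "continuous_on S v" "\<forall>x\<in>S. invertible (A x)"
  shows "continuous_on S (\<lambda>x. matrix_inv (A x) *v v x)"
proof -
  \<comment> \<open>The left side solves \<open>A x *v w = v x\<close> for \<open>w\<close>, and det
    (A x) is nonzero, so Cramer's rule gives its entry \<open>k\<close> by putting
    \<open>v x\<close> in place of column \<open>k\<close>.\<close>
  have eq: "matrix_inv (A x) *v v x =
      (\<chi> k. det (\<chi> i j. if j = k then v x $ i else A x $ i $ j) / det (A x))" if "x \<in> S" for x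
    using that assms(3) cramer[of "A x" "matrix_inv (A x) *v v x" "v x"]
    by (simp add: matrix_vector_mult_matrix_inv invertible_det_nz)
  \<comment> \<open>The condition compares indices only, so it selects the same continuous function
    for every \<open>x\<close>.\<close>
  have entry: "continuous_on S (\<lambda>x. if j = k then v x $ i else A x $ i $ j)" for i j k
    by (cases "j = k") (auto intro!: continuous_intros assms)
  have "continuous_on S (\<lambda>x. \<chi> k. det (\<chi> i j. if j = k then v x $ i else A x $ i $ j) / det (A x))"
    by (intro continuous_on_vec_lambda continuous_on_divide continuous_on_det entry assms(1) ballI)
      (use assms(3) in \<open>simp add: invertible_det_nz\<close>)
  then show ?thesis
    by (simp cong: continuous_on_cong add: eq)
qed

lemma C1_on_imp_continuous_on:
  assumes "C1_on X f"
  shows "continuous_on X f"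
  using assms unfolding C1_on_def
  by (meson continuous_at_imp_continuous_on has_derivative_continuous)

text \<open>Composition of bounded linear maps is bounded bilinear, so the derivative given by the
  chain rule inherits continuity from its two factors.\<close>

lemma C1_on_compose:
  assumes g: "C1_on Y g" and f: "C1_on X f" and "f ` X \<subseteq> Y"
  shows "C1_on X (g \<circ> f)"
proof -
  obtain f' where f': "\<And>x. x \<in> X \<Longrightarrow> (f has_derivative blinfun_apply (f' x)) (at x)"
    "continuous_on X f'" and "open X"
    using f unfolding C1_on_def by blast
  obtain g' where g': "\<And>y. y \<in> Y \<Longrightarrow> (g has_derivative blinfun_apply (g' y)) (at y)"
    "continuous_on Y g'"
    using g unfolding C1_on_def by blast
  have "continuous_on X (\<lambda>x. g' (f x) o\<^sub>L f' x)"
    by (intro bounded_bilinear.continuous_on[OF bounded_bilinear_blinfun_compose]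
        continuous_on_compose2[OF g'(2)] C1_on_imp_continuous_on f f'(2) assms(3))
  moreover have "(g \<circ> f has_derivative blinfun_apply (g' (f x) o\<^sub>L f' x)) (at x)" if "x \<in> X" for x
    using diff_chain_at[OF f'(1)[OF that] g'(1)] that assms(3)
    by (auto simp: image_subset_iff blinfun_compose.rep_eq)
  ultimately show ?thesis
    unfolding C1_on_def
    by (intro conjI \<open>open X\<close> exI[of _ "\<lambda>x. g' (f x) o\<^sub>L f' x"]) auto
qed

lemma C1_on_has_derivative_jacobian:
  fixes f :: "real ^ 'n \<Rightarrow> real ^ 'm"
  assumes "C1_on X f" "x \<in> X"
  shows "(f has_derivative (\<lambda>h. jacobian f (at x) *v h)) (at x)"
proof -
  have "f differentiable (at x)"
    using assms unfolding C1_on_def differentiable_def by blast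
  then show ?thesis
    by (simp add: jacobian_works)
qed

text \<open>By uniqueness of the derivative, the Jacobian is the matrix of the continuous witness
  from \<open>C1_on\<close>; its entries are evaluations of that witness at basis vectors.\<close>

lemma C1_on_continuous_on_jacobian:
  fixes f :: "real ^ 'n \<Rightarrow> real ^ 'm"
  assumes "C1_on X f"
  shows "continuous_on X (\<lambda>x. jacobian f (at x))"
proof -
  obtain f' where f': "\<And>x. x \<in> X \<Longrightarrow> (f has_derivative blinfun_apply (f' x)) (at x)"
    "continuous_on X f'"
    using assms unfolding C1_on_def by blast
  have eq: "jacobian f (at x) = (\<chi> i j. blinfun_apply (f' x) (axis j 1) $ i)" if "x \<in> X" for x
    using frechet_derivative_at[OF f'(1)[OF that]] by (simp add: jacobian_def matrix_def)
  have "continuous_on X (\<lambda>x. \<chi> i j. blinfun_apply (f' x) (axis j 1) $ i)"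
    by (intro continuous_on_vec_lambda continuous_intros f'(2))
  then show ?thesis
    by (simp cong: continuous_on_cong add: eq)
qed

lemma gradient_pair_transform:
  fixes X X' :: "(real ^ 'n) set"
  assumes "gradient_pair X H E z" "system_transformation X' X \<phi> U"
  shows "gradient_pair X' (H \<circ> \<phi>)
           (\<lambda>x. transpose (U x) ** E (\<phi> x) ** jacobian \<phi> (at x))
           (\<lambda>x. matrix_inv (U x) *v z (\<phi> x))"
proof -
  have H: "C1_on X H" "continuous_on X E" "continuous_on X z"
    and grad: "\<And>x. x \<in> X \<Longrightarrow> GDERIV H x :> transpose (E x) *v z x"
    using assms(1) by (auto simp: gradient_pair_def)
  have "open X'" and \<phi>: "C1_on X' \<phi>" "\<phi> ` X' = X"
    and U: "continuous_on X' U" "\<forall>x\<in>X'. invertible (U x)"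
    using assms(2) by (auto simp: system_transformation_def C1_diffeomorphism_def bij_betw_def)
  note cont\<phi> = C1_on_imp_continuous_on[OF \<phi>(1)]
  have comp: "continuous_on X' (\<lambda>x. E (\<phi> x))" "continuous_on X' (\<lambda>x. z (\<phi> x))"
    using H cont\<phi> \<phi>(2) by (auto intro: continuous_on_compose2)
  have "GDERIV (H \<circ> \<phi>) x :> transpose (transpose (U x) ** E (\<phi> x) ** jacobian \<phi> (at x)) *v
      (matrix_inv (U x) *v z (\<phi> x))" if x: "x \<in> X'" for x
  proof -
    let ?J = "jacobian \<phi> (at x)"
    have "(H has_derivative (\<lambda>h. h \<bullet> (transpose (E (\<phi> x)) *v z (\<phi> x)))) (at (\<phi> x))"
      using grad x \<phi>(2) by (auto simp: gderiv_def)
    from diff_chain_at[OF C1_on_has_derivative_jacobian[OF \<phi>(1) x] this]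
    \<comment> \<open>The chain rule gives the derivative h \<mapsto> (J h) \<bullet> g with g the
      gradient of H at \<phi>(x); moving J across the inner product shows that J^T g is the new
      gradient.\<close>
    have "GDERIV (H \<circ> \<phi>) x :> transpose ?J *v (transpose (E (\<phi> x)) *v z (\<phi> x))"
      by (simp add: gderiv_def o_def dot_lmul_matrix flip: vector_transpose_matrix)
    \<comment> \<open>Transposing reverses the factors, so \<open>U x\<close> lands next to its
      inverse and cancels.\<close>
    moreover have "transpose (transpose (U x) ** E (\<phi> x) ** ?J) *v (matrix_inv (U x) *v z (\<phi> x))
        = transpose ?J *v (transpose (E (\<phi> x)) *v (U x *v (matrix_inv (U x) *v z (\<phi> x))))"
      by (simp only: matrix_transpose_mul transpose_transpose matrix_vector_mul_assoc matrix_mul_assoc)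
    ultimately show ?thesis
      using U(2) x by (simp add: matrix_vector_mult_matrix_inv)
  qed
  then show ?thesis
    unfolding gradient_pair_def
    using \<open>open X'\<close> C1_on_compose[OF H(1) \<phi>(1)] \<phi>(2)
    by (intro conjI ballI continuous_on_matrix_inv_vector_mult continuous_on_matrix_matrix_mult
        continuous_on_transpose comp U C1_on_continuous_on_jacobian \<phi>(1)) auto
qed

lemma discrete_gradient_pair_transform:
  fixes X X' :: "(real ^ 'n) set"
  assumes "system_transformation X' X \<phi> U"
    and "discrete_gradient_pair X H E z Eb zb"
    and "discrete_jacobian X' \<phi> D\<phi>"
    and "consistent_discretization X' U Ub"
    and inv: "\<forall>x\<in>X'. \<forall>x'\<in>X'. invertible (Ub x x')"
  shows "discrete_gradient_pair X' (H \<circ> \<phi>)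
           (\<lambda>x. transpose (U x) ** E (\<phi> x) ** jacobian \<phi> (at x))
           (\<lambda>x. matrix_inv (U x) *v z (\<phi> x))
           (\<lambda>x x'. transpose (Ub x x') ** Eb (\<phi> x) (\<phi> x') ** D\<phi> x x')
           (\<lambda>x x'. matrix_inv (Ub x x') *v zb (\<phi> x) (\<phi> x'))"
proof -
  have gp: "gradient_pair X H E z"
    and Eb: "continuous_on (X \<times> X) (\<lambda>(x, x'). Eb x x')"
    and zb: "continuous_on (X \<times> X) (\<lambda>(x, x'). zb x x')"
    and disc: "\<And>x x'. x \<in> X \<Longrightarrow> x' \<in> X \<Longrightarrow> zb x x' \<bullet> (Eb x x' *v (x' - x)) = H x' - H x"
    and diag: "\<And>x. x \<in> X \<Longrightarrow> Eb x x = E x" "\<And>x. x \<in> X \<Longrightarrow> zb x x = z x"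
    using assms(2) by (auto simp: discrete_gradient_pair_def)
  \<comment> \<open>Two-argument maps are written through \<open>fst\<close> and \<open>snd\<close>,
    so that the continuity lemmas for functions of a single point \<open>p\<close> apply.\<close>
  have D: "continuous_on (X' \<times> X') (\<lambda>p. D\<phi> (fst p) (snd p))"
    and jac: "\<And>x x'. x \<in> X' \<Longrightarrow> x' \<in> X' \<Longrightarrow> D\<phi> x x' *v (x' - x) = \<phi> x' - \<phi> x"
    and Ddiag: "\<And>x. x \<in> X' \<Longrightarrow> D\<phi> x x = jacobian \<phi> (at x)"
    using assms(3) by (auto simp: discrete_jacobian_def case_prod_beta')
  have Ub: "continuous_on (X' \<times> X') (\<lambda>p. Ub (fst p) (snd p))"
    and Udiag: "\<And>x. x \<in> X' \<Longrightarrow> Ub x x = U x"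
    using assms(4) by (auto simp: consistent_discretization_def case_prod_beta')
  have \<phi>: "C1_on X' \<phi>" "\<And>x. x \<in> X' \<Longrightarrow> \<phi> x \<in> X"
    using assms(1) by (auto simp: system_transformation_def C1_diffeomorphism_def bij_betw_def)
  have \<phi>\<phi>: "continuous_on (X' \<times> X') (\<lambda>p. (\<phi> (fst p), \<phi> (snd p)))"
    by (intro continuous_on_Pair continuous_on_compose2[OF C1_on_imp_continuous_on[OF \<phi>(1)]]
        continuous_intros) auto
  have comp: "continuous_on (X' \<times> X') (\<lambda>p. Eb (\<phi> (fst p)) (\<phi> (snd p)))"
    "continuous_on (X' \<times> X') (\<lambda>p. zb (\<phi> (fst p)) (\<phi> (snd p)))"
    using continuous_on_compose2[OF Eb \<phi>\<phi>] continuous_on_compose2[OF zb \<phi>\<phi>] \<phi>(2)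
    by (simp_all add: image_subset_iff)
  have "(matrix_inv (Ub x x') *v zb (\<phi> x) (\<phi> x')) \<bullet>
      ((transpose (Ub x x') ** Eb (\<phi> x) (\<phi> x') ** D\<phi> x x') *v (x' - x)) = H (\<phi> x') - H (\<phi> x)"
    if x: "x \<in> X'" "x' \<in> X'" for x x'
  proof -
    let ?w = "matrix_inv (Ub x x') *v zb (\<phi> x) (\<phi> x')"
    have "?w \<bullet> ((transpose (Ub x x') ** Eb (\<phi> x) (\<phi> x') ** D\<phi> x x') *v (x' - x))
        = ?w \<bullet> (transpose (Ub x x') *v (Eb (\<phi> x) (\<phi> x') *v (D\<phi> x x' *v (x' - x))))"
      by (simp only: matrix_vector_mul_assoc matrix_mul_assoc)
    \<comment> \<open>The discrete Jacobian turns the increment of x into that of \<phi>, and the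
      transpose moves across the inner product onto \<open>?w\<close>, where \<open>Ub x x'\<close>
      will cancel its inverse. The commutations bring both sides into the shape handled by
      \<open>dot_lmul_matrix\<close>.\<close>
    also have "\<dots> = (Ub x x' *v ?w) \<bullet> (Eb (\<phi> x) (\<phi> x') *v (\<phi> x' - \<phi> x))"
      by (simp add: jac x dot_lmul_matrix inner_commute[of ?w] inner_commute[of "Ub x x' *v ?w"])
    also have "\<dots> = H (\<phi> x') - H (\<phi> x)"
      using inv x by (simp add: matrix_vector_mult_matrix_inv disc \<phi>(2))
    finally show ?thesis .
  qed
  moreover have "continuous_on (X' \<times> X')
      (\<lambda>p. transpose (Ub (fst p) (snd p)) ** Eb (\<phi> (fst p)) (\<phi> (snd p)) ** D\<phi> (fst p) (snd p))"
    by (intro continuous_on_matrix_matrix_mult continuous_on_transpose comp D Ub)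
  moreover have "continuous_on (X' \<times> X')
      (\<lambda>p. matrix_inv (Ub (fst p) (snd p)) *v zb (\<phi> (fst p)) (\<phi> (snd p)))"
    using inv by (intro continuous_on_matrix_inv_vector_mult comp Ub) auto
  ultimately show ?thesis
    \<comment> \<open>On the diagonal each discrete factor reduces to its continuous counterpart, so
      the transformed discrete pair reduces to the transformed pair.\<close>
    unfolding discrete_gradient_pair_def
    using gradient_pair_transform[OF gp assms(1)]
    by (simp add: case_prod_beta' Udiag Ddiag diag \<phi>(2))
qed

theorem theorem5p5:
  fixes X X' :: "(real ^ 'n) set"
    and H :: "real ^ 'n \<Rightarrow> real"
    and E U :: "real ^ 'n \<Rightarrow> real ^ 'n ^ 'n"
    and z \<phi> :: "real ^ 'n \<Rightarrow> real ^ 'n"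
  assumes "open X"
    and "C1_on X H"
    and "gradient_pair X H E z"
    and "system_transformation X' X \<phi> U"
  shows "gradient_pair X' (H \<circ> \<phi>)
           (\<lambda>x. transpose (U x) ** E (\<phi> x) ** jacobian \<phi> (at x))
           (\<lambda>x. matrix_inv (U x) *v z (\<phi> x)) \<and>
         (\<forall>Eb zb D\<phi> Ub.
           discrete_gradient_pair X H E z Eb zb \<longrightarrow>
           discrete_jacobian X' \<phi> D\<phi> \<longrightarrow>
           consistent_discretization X' U Ub \<longrightarrow>
           (\<forall>x\<in>X'. \<forall>x'\<in>X'. invertible (Ub x x')) \<longrightarrow>
           discrete_gradient_pair X' (H \<circ> \<phi>)
             (\<lambda>x. transpose (U x) ** E (\<phi> x) ** jacobian \<phi> (at x))
             (\<lambda>x. matrix_inv (U x) *v z (\<phi> x))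
             (\<lambda>x x'. transpose (Ub x x') ** Eb (\<phi> x) (\<phi> x') ** D\<phi> x x')
             (\<lambda>x x'. matrix_inv (Ub x x') *v zb (\<phi> x) (\<phi> x')))"
  using gradient_pair_transform[OF assms(3,4)] discrete_gradient_pair_transform[OF assms(4)]
  by blast

end
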